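(* Let $n\ge 2k\ge 6$. Let $\mathbb{S}$ be a $q$-covering design $\mathcal{C}_2(n-k+2,k,3)$ (a set of $k$-dimensional subspaces of $\mathbb{F}_2^{n-k+2}$ covering every $3$-dimensional subspace). Suppose $U_0\subseteq\mathbb{F}_2^{n-k+2}$ is an $(n-k)$-dimensional subspace and $U_1,U_2,U_3\subseteq\mathbb{F}_2^{n-k+2}$ are $(n-k+1)$-dimensional subspaces with $U_i\cap U_j=U_0$ for $1\le i<j\le 3$. Let $c_i=|\{X\in\mathbb{S}: X\subseteq U_i\}|$ for $i=0,1,2,3$, and suppose $c_1\le c_2\le c_3$. Then $$\mathcal{C}_2(n,k,3)\le 2^{3(n-k)}+\binom{k}{2}_2\,(|\mathbb{S}|-c_1-c_2-c_3+2c_0)+(2^k-1)(c_1-c_0)+\mathcal{C}_2(n-k,k,3).$$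
   Context: $\binom{k}{2}_2=\frac{(2^k-1)(2^{k-1}-1)}{3}$ is the Gaussian coefficient (number of $2$-dimensional subspaces of $\mathbb{F}_2^k$). A $q$-covering design $\mathcal{C}_q(n,k,r)$ is a collection of $k$-dimensional subspaces of $\mathbb{F}_q^n$ such that every $r$-dimensional subspace is contained in at least one member; $\mathcal{C}_q(n,k,r)$ is the minimum size of such a collection. *)

theory Defs
  imports Main HOL.Vector_Spaces "HOL-Library.Z2" "HOL-Library.Function_Algebras"
begin

text \<open>Vectors of F_2^n are modelled as functions nat => bit vanishing outside {0..<n}.\<close>

definition scale2 :: "bit \<Rightarrow> (nat \<Rightarrow> bit) \<Rightarrow> (nat \<Rightarrow> bit)" where
  "scale2 c v = (\<lambda>i. c * v i)"

definition Fvec :: "nat \<Rightarrow> (nat \<Rightarrow> bit) set" where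
  "Fvec n = {v. \<forall>i\<ge>n. v i = 0}"

interpretation F2: vector_space scale2
  by unfold_locales (auto simp: scale2_def fun_eq_iff algebra_simps)

definition is_subspace :: "nat \<Rightarrow> nat \<Rightarrow> (nat \<Rightarrow> bit) set \<Rightarrow> bool" where
  "is_subspace n d U \<longleftrightarrow> U \<subseteq> Fvec n \<and> F2.subspace U \<and> F2.dim U = d"

definition is_covering_design :: "nat \<Rightarrow> nat \<Rightarrow> nat \<Rightarrow> (nat \<Rightarrow> bit) set set \<Rightarrow> bool" where
  "is_covering_design n k r C \<longleftrightarrow>
     finite C \<and> (\<forall>X\<in>C. is_subspace n k X) \<and>
     (\<forall>W. is_subspace n r W \<longrightarrow> (\<exists>X\<in>C. W \<subseteq> X))"

definition covering_number :: "nat \<Rightarrow> nat \<Rightarrow> nat \<Rightarrow> nat" where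
  "covering_number n k r = (LEAST m. \<exists>C. is_covering_design n k r C \<and> card C = m)"

definition gauss2 :: "nat \<Rightarrow> nat" where
  "gauss2 k = ((2^k - 1) * (2^(k-1) - 1)) div 3"

end

theory Submission
  imports Defs "HOL-Algebra.Algebraic_Closure_Type"
begin

text \<open>Put \<open>m = n - k\<close>, let \<open>Y\<close> be an \<open>m\<close>-dimensional subspace of the ambient \<open>n\<close>-dimensional space
  and identify the quotient by \<open>Y\<close> with the \<open>k\<close>-dimensional space. A 3-dimensional subspace \<open>W\<close> is
  covered according to its image \<open>A\<close> in the quotient.

  If \<open>dim A = 3\<close>, then \<open>W\<close> lies in a member of a lifted Gabidulin code: the graphs of the maps
  \<open>z \<mapsto> a z + b z\<^sup>2 + c z\<^sup>4\<close> over the field with \<open>2 ^ m\<close> elements, which interpolate every linear map on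
  a 3-dimensional space. If \<open>A = 0\<close>, a covering design of \<open>Y\<close> is used.

  For every line \<open>T\<close> (2-dimensional subspace) of the quotient, choose an isomorphism of the
  \<open>(m + 2)\<close>-dimensional space onto the preimage of \<open>T\<close> which carries \<open>U0\<close> to \<open>Y\<close> and \<open>U1\<close> to the
  preimage of a selected point of \<open>T\<close>. If \<open>A = T\<close>, then \<open>W\<close> is covered by the image of a member of \<open>S\<close>
  which lies in none of \<open>U1\<close>, \<open>U2\<close>, \<open>U3\<close>. If \<open>A\<close> is a point, then it may be necessary to use a member
  of \<open>S\<close> inside \<open>U1\<close>, for a single line on which \<open>A\<close> is the selected point. Every point is the
  selected point of some line because there is an injective map sending each point to a line
  through it.\<close>

\<comment> \<open>This notation of \<open>HOL-Algebra\<close> would prevent \<open>X\<close> from being used as a variable.\<close>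
no_notation var (\<open>X\<index>\<close>)

section \<open>Elementary abelian 2-groups\<close>

text \<open>Subspaces over the field with two elements, without reference to a scalar multiplication, so
  that coordinate spaces and finite fields are treated alike.\<close>
definition sub2 :: "'a::ab_group_add set \<Rightarrow> bool" where
  "sub2 U \<longleftrightarrow> 0 \<in> U \<and> (\<forall>x\<in>U. \<forall>y\<in>U. x + y \<in> U) \<and> (\<forall>x\<in>U. x + x = 0)"

definition additive_on :: "'a::ab_group_add set \<Rightarrow> ('a \<Rightarrow> 'b::ab_group_add) \<Rightarrow> bool" where
  "additive_on U f \<longleftrightarrow> (\<forall>x\<in>U. \<forall>y\<in>U. f (x + y) = f x + f y)"

lemma sub2_zero: "sub2 U \<Longrightarrow> 0 \<in> U"
  and sub2_add: "sub2 U \<Longrightarrow> x \<in> U \<Longrightarrow> y \<in> U \<Longrightarrow> x + y \<in> U"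
  and sub2_self: "sub2 U \<Longrightarrow> x \<in> U \<Longrightarrow> x + x = 0"
  by (auto simp: sub2_def)

lemma additive_onD: "additive_on U f \<Longrightarrow> x \<in> U \<Longrightarrow> y \<in> U \<Longrightarrow> f (x + y) = f x + f y"
  by (auto simp: additive_on_def)

lemma self_add_cancel_left: "u + u = 0 \<Longrightarrow> u + (u + x) = x" for u x :: "'a::ab_group_add"
  by (simp flip: add.assoc)

lemma add_self_shift:
  fixes u a b :: "'a::ab_group_add"
  assumes "u + u = 0" shows "u + a + (u + b) = a + b"
proof -
  have "u + a + (u + b) = u + u + (a + b)" by (simp only: add_ac)
  thus ?thesis using assms by simp
qed

lemma sub2_coset_notin:
  assumes "sub2 U" "x \<in> U" "u \<notin> U"
  shows "u + x \<notin> U"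
proof
  assume "u + x \<in> U"
  hence "u + x + x \<in> U" using assms sub2_add by blast
  thus False using assms sub2_self[OF assms(1,2)] by (simp add: add.assoc)
qed

lemma additive_on_zero:
  assumes "sub2 U" "additive_on U f" shows "f 0 = 0"
proof -
  have "f (0 + 0) = f 0 + f 0" using assms sub2_zero additive_onD by blast
  thus ?thesis by simp
qed

lemma additive_on_subset: "additive_on U f \<Longrightarrow> V \<subseteq> U \<Longrightarrow> additive_on V f"
  by (auto simp: additive_on_def)

lemma additive_on_comp:
  "additive_on U f \<Longrightarrow> additive_on V g \<Longrightarrow> f ` U \<subseteq> V \<Longrightarrow> additive_on U (\<lambda>x. g (f x))"
  unfolding additive_on_def by (simp add: image_subset_iff)

lemma sub2_singleton: "sub2 {0}"
  by (auto simp: sub2_def)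

lemma sub2_image:
  assumes "sub2 U" "additive_on U f" shows "sub2 (f ` U)"
proof -
  have "f x + f x = 0" if "x \<in> U" for x
    using that assms additive_on_zero additive_onD sub2_self by metis
  moreover have "f x + f y \<in> f ` U" if "x \<in> U" "y \<in> U" for x y
    using that assms additive_onD sub2_add by (metis imageI)
  moreover have "0 \<in> f ` U" using additive_on_zero[OF assms] sub2_zero[OF assms(1)] by (metis imageI)
  ultimately show ?thesis by (auto simp: sub2_def)
qed

lemma sub2_vimage:
  assumes "sub2 U" "additive_on U f" "sub2 A" shows "sub2 {x \<in> U. f x \<in> A}"
proof -
  have "0 \<in> {x \<in> U. f x \<in> A}"
    using additive_on_zero[OF assms(1,2)] sub2_zero[OF assms(1)] sub2_zero[OF assms(3)] by simp
  moreover have "x + y \<in> {x \<in> U. f x \<in> A}" if "x \<in> {x \<in> U. f x \<in> A}" "y \<in> {x \<in> U. f x \<in> A}" for x y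
    using that additive_onD[OF assms(2)] sub2_add[OF assms(1)] sub2_add[OF assms(3)] by simp
  ultimately show ?thesis using sub2_self[OF assms(1)] by (simp add: sub2_def)
qed

lemma additive_on_inj_on:
  assumes "sub2 U" "additive_on U f" "\<And>x. x \<in> U \<Longrightarrow> f x = 0 \<Longrightarrow> x = 0"
  shows "inj_on f U"
proof (rule inj_onI)
  fix x y assume xy: "x \<in> U" "y \<in> U" "f x = f y"
  have "f (x + y) = f (y + y)" using xy by (simp add: additive_onD[OF assms(2)])
  also have "\<dots> = 0" using xy assms by (simp add: sub2_self additive_on_zero)
  finally have "x + y = 0" using assms xy by (simp add: sub2_add)
  moreover have "y + y = 0" using sub2_self assms(1) xy(2) by blast
  ultimately show "x = y" by (metis add_right_cancel)
qed

lemma sub2_extend: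
  assumes "sub2 U" "u + u = 0"
  shows "sub2 (U \<union> (+) u ` U)"
  unfolding sub2_def
proof (intro conjI ballI)
  show "0 \<in> U \<union> (+) u ` U" using assms sub2_zero by auto
next
  fix x assume "x \<in> U \<union> (+) u ` U"
  thus "x + x = 0" using assms by (auto simp: sub2_self add_self_shift)
next
  fix x y assume *: "x \<in> U \<union> (+) u ` U" "y \<in> U \<union> (+) u ` U"
  then consider "x \<in> U" "y \<in> U" | x' where "x = u + x'" "x' \<in> U" "y \<in> U"
    | y' where "x \<in> U" "y' \<in> U" "y = u + y'" | x' y' where "x' \<in> U" "y' \<in> U" "x = u + x'" "y = u + y'"
    by blast
  thus "x + y \<in> U \<union> (+) u ` U"
  proof cases
    case 3
    have "x + y = u + (x + y')" using 3 by (simp add: add.left_commute)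
    thus ?thesis using 3 assms sub2_add by blast
  next
    case 4 thus ?thesis using assms by (simp add: sub2_add add_self_shift)
  qed (use assms in \<open>auto simp: sub2_add add.assoc\<close>)
qed

lemma card_extend:
  assumes "sub2 U" "finite U" "u + u = 0" "u \<notin> U"
  shows "card (U \<union> (+) u ` U) = 2 * card U"
proof -
  have "U \<inter> (+) u ` U = {}"
    using assms sub2_coset_notin by blast
  thus ?thesis using assms by (simp add: card_Un_disjoint card_image)
qed

section \<open>Extension of additive bijections\<close>

lemma extend_additive_bij:
  fixes f :: "'a::ab_group_add \<Rightarrow> 'b::ab_group_add"
  assumes U: "sub2 U" "u + u = 0" "u \<notin> U" and V: "sub2 V" "v + v = 0" "v \<notin> V"
    and f: "additive_on U f" "bij_betw f U V"
  shows "\<exists>g. additive_on (U \<union> (+) u ` U) g \<and>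
    bij_betw g (U \<union> (+) u ` U) (V \<union> (+) v ` V) \<and> (\<forall>x\<in>U. g x = f x)"
proof -
  \<comment> \<open>For \<open>x\<close> in the coset of \<open>u\<close>, the component in
    \<open>U\<close> is \<open>u + x\<close>, because \<open>u + u = 0\<close>. Requiring
    \<open>u\<close> to go to \<open>v\<close> then forces this value.\<close>
  define g where "g x = (if x \<in> U then f x else v + f (u + x))" for x
  have uU: "u + x \<notin> U" if "x \<in> U" for x
    using that U sub2_coset_notin by blast
  have g1: "g x = f x" if "x \<in> U" for x using that by (simp add: g_def)
  have g2: "g (u + x) = v + f x" if "x \<in> U" for x
    using that uU U by (simp add: g_def self_add_cancel_left)
  have cu: "u + a + (u + b) = a + b" for a b
    using U(2) by (rule add_self_shift)
  have cv: "v + a + (v + b) = a + b" for a b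
    using V(2) by (rule add_self_shift)
  have fV: "f x \<in> V" if "x \<in> U" for x using that f(2) bij_betwE by auto
  have add: "additive_on (U \<union> (+) u ` U) g"
    unfolding additive_on_def
  proof (intro ballI)
    fix x y assume *: "x \<in> U \<union> (+) u ` U" "y \<in> U \<union> (+) u ` U"
    then consider "x \<in> U" "y \<in> U" | x' where "x = u + x'" "x' \<in> U" "y \<in> U"
      | y' where "x \<in> U" "y' \<in> U" "y = u + y'" | x' y' where "x' \<in> U" "y' \<in> U" "x = u + x'" "y = u + y'"
      by blast
    thus "g (x + y) = g x + g y"
    proof cases
      case 1 thus ?thesis using g1 f U by (simp add: sub2_add additive_onD)
    next
      case 2 thus ?thesis using g1 g2 f U by (simp add: sub2_add additive_onD add.assoc)
    next
      case 3
      have "x + (u + y') = u + (x + y')" by (simp add: add.left_commute)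
      with 3 show ?thesis using g1 g2[of "x + y'"] g2[of y'] f U
        by (simp add: sub2_add additive_onD add.left_commute)
    next
      case 4 thus ?thesis using g1[of "x' + y'"] g2 f U by (simp add: sub2_add additive_onD cu cv)
    qed
  qed
  have inj: "inj_on g (U \<union> (+) u ` U)"
  proof (rule additive_on_inj_on[OF sub2_extend[OF U(1,2)] add])
    fix x assume x: "x \<in> U \<union> (+) u ` U" "g x = 0"
    have z: "f 0 = 0" using additive_on_zero U f by blast
    from x(1) show "x = 0"
    proof
      assume "x \<in> U" thus "x = 0" using x(2) g1 z f(2) sub2_zero[OF U(1)]
        by (metis bij_betw_imp_inj_on inj_on_def)
    next
      assume "x \<in> (+) u ` U"
      then obtain y where y: "x = u + y" "y \<in> U" by auto
      hence "v + f y = 0" using g2 x by simp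
      hence "v = f y" using V(2) by (metis add_left_cancel)
      thus ?thesis using fV y V by simp
    qed
  qed
  have fUV: "f ` U = V" using f(2) by (simp add: bij_betw_def)
  have "g ` U = V" using g1 fUV by (simp cong: image_cong)
  moreover have "g ` ((+) u ` U) = (+) v ` V"
    unfolding fUV[symmetric] image_image using g2 by (simp cong: image_cong)
  ultimately have "g ` (U \<union> (+) u ` U) = V \<union> (+) v ` V" by (simp add: image_Un)
  with add inj g1 show ?thesis by (auto simp: bij_betw_def)
qed

text \<open>One generator at a time is adjoined on both sides. Since \<open>U\<close> and
  \<open>V\<close> have equal orders, and so do \<open>U'\<close> and \<open>V'\<close>, both sides
  are exhausted at the same stage. Prolonging a given map makes it possible to match chains of
  subspaces.\<close>

lemma additive_bij_extends:
  fixes f :: "'a::ab_group_add \<Rightarrow> 'b::ab_group_add"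
  assumes "sub2 U" "sub2 V" "additive_on U f" "bij_betw f U V"
    and "sub2 U'" "sub2 V'" "finite U'" "finite V'" "card U' = card V'" "U \<subseteq> U'" "V \<subseteq> V'"
  shows "\<exists>g. additive_on U' g \<and> bij_betw g U' V' \<and> (\<forall>x\<in>U. g x = f x)"
  using assms
proof (induction "card U' - card U" arbitrary: U V f rule: less_induct)
  case less
  have cUV: "card U = card V" using less.prems(4) bij_betw_same_card by blast
  have fin: "finite U" "finite V" using less.prems finite_subset by blast+
  show ?case
  proof (cases "U = U'")
    case True
    hence "V = V'" using less.prems cUV by (metis card_subset_eq)
    thus ?thesis using True less.prems by blast
  next
    case False
    then obtain u where u: "u \<in> U'" "u \<notin> U" using less.prems by blast
    have "V \<noteq> V'" using False less.prems cUV by (metis card_subset_eq)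
    then obtain v where v: "v \<in> V'" "v \<notin> V" using less.prems by blast
    have uu: "u + u = 0" "v + v = 0" using u v less.prems sub2_self by blast+
    obtain g where g: "additive_on (U \<union> (+) u ` U) g"
        "bij_betw g (U \<union> (+) u ` U) (V \<union> (+) v ` V)" "\<forall>x\<in>U. g x = f x"
      using extend_additive_bij[OF less.prems(1) uu(1) u(2) less.prems(2) uu(2) v(2) less.prems(3,4)]
      by blast
    have sub: "U \<union> (+) u ` U \<subseteq> U'" "V \<union> (+) v ` V \<subseteq> V'"
      using less.prems u v sub2_add by blast+
    have "card U > 0" using less.prems fin sub2_zero by (metis card_gt_0_iff empty_iff)
    hence "card U < card (U \<union> (+) u ` U)" using card_extend[OF less.prems(1) fin(1) uu(1) u(2)] by simp
    moreover have "card (U \<union> (+) u ` U) \<le> card U'" using sub less.prems card_mono by blast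
    ultimately have "card U' - card (U \<union> (+) u ` U) < card U' - card U" by linarith
    from less.hyps[OF this sub2_extend[OF less.prems(1) uu(1)] sub2_extend[OF less.prems(2) uu(2)] g(1,2)
         less.prems(5-9) sub]
    obtain h where "additive_on U' h" "bij_betw h U' V'" "\<forall>x\<in>U \<union> (+) u ` U. h x = g x" by blast
    thus ?thesis using g(3) by (metis UnCI)
  qed
qed

lemma additive_bij_exists:
  fixes U :: "'a::ab_group_add set" and V :: "'b::ab_group_add set"
  assumes "sub2 U" "sub2 V" "finite U" "finite V" "card U = card V"
  shows "\<exists>g. additive_on U g \<and> bij_betw g U V"
proof -
  have "additive_on {0::'a} (\<lambda>_. 0::'b)" "bij_betw (\<lambda>_. 0::'b) {0::'a} {0}"
    by (auto simp: additive_on_def bij_betw_def)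
  from additive_bij_extends[OF sub2_singleton sub2_singleton this assms] sub2_zero[OF assms(1)] sub2_zero[OF assms(2)]
  show ?thesis by blast
qed

section \<open>Orders of subgroups\<close>

lemma sub2_between:
  assumes "sub2 U" "sub2 V" "finite V" "U \<subseteq> V" "card U = 2 ^ d" "card V = 2 ^ e" "d \<le> c" "c \<le> e"
  shows "\<exists>W. sub2 W \<and> U \<subseteq> W \<and> W \<subseteq> V \<and> card W = 2 ^ c"
  using assms(7,8)
proof (induction c rule: dec_induct)
  case base thus ?case using assms by blast
next
  case (step c)
  then obtain W where W: "sub2 W" "U \<subseteq> W" "W \<subseteq> V" "card W = 2 ^ c" by auto
  have "W \<noteq> V" using W assms(6) step.prems by auto
  then obtain u where u: "u \<in> V" "u \<notin> W" using W by blast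
  have uu: "u + u = 0" using u assms sub2_self by blast
  have "W \<union> (+) u ` W \<subseteq> V" using W u sub2_add[OF assms(2)] by blast
  moreover have "card (W \<union> (+) u ` W) = 2 ^ Suc c"
    using card_extend W u uu finite_subset assms(3) by (metis power_Suc)
  ultimately show ?case using sub2_extend[OF W(1) uu] W by blast
qed

text \<open>A subgroup that is maximal among those whose order is a power of two must be all of
  \<open>U\<close>: adjoining an outside element would double its order.\<close>

lemma card_sub2:
  assumes "sub2 U" "finite U" shows "\<exists>d. card U = 2 ^ d"
proof -
  define D where "D = {W. sub2 W \<and> W \<subseteq> U \<and> (\<exists>d. card W = 2 ^ d)}"
  have "finite D" using assms(2) unfolding D_def by (auto intro: finite_subset[of _ "Pow U"])
  moreover have "{0} \<in> D" using assms sub2_zero sub2_singleton by (auto simp: D_def intro: exI[of _ 0])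
  ultimately obtain W where W: "W \<in> D" "\<And>X. X \<in> D \<Longrightarrow> W \<subseteq> X \<Longrightarrow> X = W"
    using finite_has_maximal[of D] by (metis empty_iff)
  have "W = U"
  proof (rule ccontr)
    assume "W \<noteq> U"
    then obtain u where u: "u \<in> U" "u \<notin> W" using W D_def by blast
    have uu: "u + u = 0" using u assms sub2_self by blast
    obtain d where d: "card W = 2 ^ d" using W D_def by blast
    have "card (W \<union> (+) u ` W) = 2 ^ Suc d"
      using card_extend[of W u] W(1) u uu finite_subset[OF _ assms(2)] d by (auto simp: D_def)
    moreover have "W \<union> (+) u ` W \<subseteq> U" using W(1) u sub2_add[OF assms(1)] by (auto simp: D_def)
    moreover have "sub2 (W \<union> (+) u ` W)" using sub2_extend W(1) uu by (auto simp: D_def)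
    ultimately have "W \<union> (+) u ` W \<in> D" unfolding D_def by blast
    hence "W \<union> (+) u ` W = W" using W(2) by blast
    moreover have "u + 0 \<in> (+) u ` W" using W(1) sub2_zero unfolding D_def by blast
    ultimately show False using u by auto
  qed
  thus ?thesis using W by (auto simp: D_def)
qed

lemma sub2_doubleton: "p + p = 0 \<Longrightarrow> sub2 {0, p}"
  by (auto simp: sub2_def)

lemma sub2_four:
  assumes "sub2 T" "card T = 4" "v \<in> T" "w \<in> T" "v \<noteq> 0" "w \<noteq> 0" "v \<noteq> w"
  shows "T = {0, v, w, v + w}"
proof -
  have "v + w \<noteq> 0" "v + w \<noteq> v" "v + w \<noteq> w"
    using assms by (auto simp: sub2_self) (metis add_left_cancel sub2_self)
  hence "card {0, v, w, v + w} = 4" using assms by auto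
  moreover have "{0, v, w, v + w} \<subseteq> T" using assms by (auto simp: sub2_zero sub2_add)
  moreover have "finite T" using assms(2) card.infinite by fastforce
  ultimately show ?thesis using assms(2) by (metis card_subset_eq)
qed

text \<open>Sets of orders 1, 2 and 4 cannot exhaust \<open>W\<close>, so three successive doublings
  reach it. Generation is phrased through subgroups \<open>U\<close> so that an additive condition
  on all of \<open>W\<close> can be checked at three elements.\<close>

lemma sub2_eight_generated:
  assumes "sub2 W" "card W = 8"
  obtains w1 w2 w3 where "w1 \<in> W" "w2 \<in> W" "w3 \<in> W"
    "\<And>U. sub2 U \<Longrightarrow> w1 \<in> U \<Longrightarrow> w2 \<in> U \<Longrightarrow> w3 \<in> U \<Longrightarrow> W \<subseteq> U"
proof -
  have fin: "finite W" using assms(2) card.infinite by fastforce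
  have small: "\<exists>w\<in>W. w \<notin> A" if "finite A" "card A < 8" for A
    using that assms by (metis card_mono leD subsetI)
  obtain w1 where w1: "w1 \<in> W" "w1 \<notin> {0}" using small[of "{0}"] by auto
  define U1 where "U1 = {0} \<union> (+) w1 ` {0}"
  have c1: "card U1 = 2" "sub2 U1" "finite U1" unfolding U1_def
    using card_extend[OF sub2_singleton, of w1] sub2_extend[OF sub2_singleton, of w1] w1 sub2_self[OF assms(1)] by auto
  obtain w2 where w2: "w2 \<in> W" "w2 \<notin> U1" using small[of U1] c1 by auto
  define U2 where "U2 = U1 \<union> (+) w2 ` U1"
  have c2: "card U2 = 4" "sub2 U2" "finite U2" unfolding U2_def
    using card_extend[OF c1(2,3) _ w2(2)] sub2_extend[OF c1(2)] w2 sub2_self[OF assms(1)] c1 by auto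
  obtain w3 where w3: "w3 \<in> W" "w3 \<notin> U2" using small[of U2] c2 by auto
  define U3 where "U3 = U2 \<union> (+) w3 ` U2"
  have c3: "card U3 = 8" unfolding U3_def
    using card_extend[OF c2(2,3) _ w3(2)] w3 sub2_self[OF assms(1)] c2 by auto
  have sub: "U3 \<subseteq> U" if "sub2 U" "w1 \<in> U" "w2 \<in> U" "w3 \<in> U" for U
    unfolding U3_def U2_def U1_def using that by (auto simp: sub2_zero sub2_add)
  have "U3 = W" using sub[OF assms(1) w1(1) w2(1) w3(1)] c3 assms fin by (metis card_subset_eq)
  with sub show ?thesis by (intro that[OF w1(1) w2(1) w3(1)]) simp
qed

section \<open>Finite fields of characteristic two\<close>

text \<open>For \<open>m > 0\<close> this is the field with \<open>2 ^ m\<close> elements; \<open>GF 0\<close> is the whole algebraic closure.\<close>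
definition GF :: "nat \<Rightarrow> bit alg_closure set" where
  "GF m = {x. x ^ (2 ^ m) = x}"

lemma ac_two: "(2 :: bit alg_closure) = 0"
  using to_ac_numeral[where 'a=bit, of "Num.Bit0 Num.One"] by simp

lemma ac_self: "x + x = 0" for x :: "bit alg_closure"
  using mult_2[of x] by (simp add: ac_two)

lemma ac_add_pow: "(x + y) ^ (2 ^ m) = x ^ (2 ^ m) + y ^ (2 ^ m)" for x y :: "bit alg_closure"
proof (induction m)
  case (Suc m)
  have "z ^ (2 ^ Suc m) = (z ^ (2 ^ m)) ^ 2" for z :: "bit alg_closure"
    by (metis power_Suc2 power_mult)
  thus ?case using Suc by (simp add: power2_sum ac_two)
qed simp

lemma GF_sub2: "sub2 (GF m)"
  unfolding sub2_def GF_def by (simp add: ac_self ac_add_pow power_0_left)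

lemma GF_mult: "x \<in> GF m \<Longrightarrow> y \<in> GF m \<Longrightarrow> x * y \<in> GF m"
  unfolding GF_def by (simp add: power_mult_distrib)

text \<open>The elements are the roots of \<open>x ^ (2 ^ m) + x\<close>. Its derivative is 1, so
  all roots in the algebraic closure are simple and their number is the degree.\<close>

lemma GF_card:
  assumes "m > 0" shows "finite (GF m)" "card (GF m) = 2 ^ m"
proof -
  define p :: "bit alg_closure poly" where "p = monom 1 (2 ^ m) + [:0, 1:]"
  have m1: "(2::nat) ^ m > 1" using assms by (metis one_less_numeral_iff one_less_power semiring_norm(76))
  have deg: "degree p = 2 ^ m"
    unfolding p_def using m1 by (subst degree_add_eq_left) (auto simp: degree_monom_eq)
  hence p0: "p \<noteq> 0" using m1 by auto
  have ev: "poly p x = x ^ (2 ^ m) + x" for x by (simp add: p_def poly_monom)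
  have root: "poly p x = 0 \<longleftrightarrow> x \<in> GF m" for x
    unfolding ev GF_def mem_Collect_eq using ac_self[of x] add_right_cancel[of "x ^ 2 ^ m" x x] by metis
  \<comment> \<open>Since \<open>m > 0\<close>, the leading exponent is even and the derivative of
    the leading term vanishes.\<close>
  have "(of_nat (2 ^ m) :: bit alg_closure) = 0" using assms by (simp add: ac_two)
  hence pd: "pderiv p = 1"
    unfolding p_def by (simp add: pderiv_add pderiv_monom pderiv_pCons one_pCons)
  obtain A where A: "size A = degree p" "p = smult (lead_coeff p) (\<Prod>x\<in>#A. [:-x, 1:])"
    using alg_closed_imp_factorization[OF p0] by blast
  have "count A a \<le> 1" for a
  proof (rule ccontr)
    assume "\<not> count A a \<le> 1"
    hence "{#a, a#} \<subseteq># A" by (auto simp: subseteq_mset_def)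
    then obtain B where "A = {#a, a#} + B" using mset_subset_eq_exists_conv by metis
    hence "p = [:-a, 1:] * ([:-a, 1:] * smult (lead_coeff p) (\<Prod>x\<in>#B. [:-x, 1:]))"
      (is "p = _ * (_ * ?q)") using A(2) by (simp add: mult_smult_right)
    hence "pderiv p = pderiv ([:-a, 1:] * ([:-a, 1:] * ?q))" by simp
    hence "poly (pderiv p) a = 0"
      unfolding pderiv_mult poly_add poly_mult by simp
    thus False using pd by simp
  qed
  \<comment> \<open>Without multiplicities, the size of the multiset of roots counts distinct
    roots.\<close>
  hence "A = mset_set (set_mset A)"
    by (intro multiset_eqI) (simp add: count_mset_set' not_in_iff le_antisym Suc_leI)
  hence "size A = card (set_mset A)" by (metis size_mset_set)
  moreover have "set_mset A = {x. poly p x = 0}"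
  proof -
    have "poly p x = lead_coeff p * (\<Prod>a\<in>#A. x - a)" for x
      by (subst A(2)) (simp add: poly_prod_mset image_mset.compositionality o_def)
    thus ?thesis using p0 by (auto simp: prod_mset_zero_iff)
  qed
  ultimately show "card (GF m) = 2 ^ m" "finite (GF m)" using A(1) deg root
    by (auto simp: set_eq_iff intro: arg_cong[where f=card] finite_subset[of _ "set_mset A"])
qed

section \<open>Coordinate spaces\<close>

lemma vec_self: "x + x = 0" for x :: "nat \<Rightarrow> bit"
  by (auto simp: fun_eq_iff)

lemma subspace_iff_sub2: "F2.subspace U \<longleftrightarrow> sub2 U"
proof -
  have "scale2 c x = (if c = 0 then 0 else x)" for c x by (auto simp: scale2_def fun_eq_iff)
  thus ?thesis by (auto simp: F2.subspace_def sub2_def vec_self)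
qed

text \<open>A new independent vector \<open>b\<close> adds exactly one disjoint coset, so the span
  doubles.\<close>

lemma card_span:
  assumes "finite B" "F2.independent B"
  shows "finite (F2.span B) \<and> card (F2.span B) = 2 ^ card B"
  using assms
proof (induction B rule: finite_induct)
  case empty thus ?case by simp
next
  case (insert b B)
  have ind: "F2.independent B" "b \<notin> F2.span B"
    using insert F2.independent_insert[of b B] by auto
  have sub: "sub2 (F2.span B)" using subspace_iff_sub2 F2.subspace_span by blast
  have sc: "scale2 c x = (if c = 0 then 0 else x)" for c x by (auto simp: scale2_def fun_eq_iff)
  have "F2.span (insert b B) = F2.span B \<union> (+) b ` F2.span B"
  proof (intro Set.set_eqI iffI)
    fix x assume "x \<in> F2.span (insert b B)"
    then obtain c where c: "x - scale2 c b \<in> F2.span B" by (auto simp: F2.span_insert)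
    show "x \<in> F2.span B \<union> (+) b ` F2.span B"
    proof (cases "c = 0")
      case False
      hence "x - b \<in> F2.span B" using c by (simp add: sc)
      moreover have "x = b + (x - b)" by simp
      ultimately show ?thesis by blast
    qed (use c sc in auto)
  next
    fix x assume "x \<in> F2.span B \<union> (+) b ` F2.span B"
    thus "x \<in> F2.span (insert b B)"
      by (auto intro: F2.span_add F2.span_base F2.span_mono[THEN subsetD, rotated])
  qed
  thus ?case using card_extend[OF sub _ vec_self ind(2)] insert ind by simp
qed

lemma Fvec_Suc: "Fvec (Suc n) = Fvec n \<union> (+) (\<lambda>i. of_bool (i = n)) ` Fvec n"
proof (intro Set.set_eqI iffI)
  fix x :: "nat \<Rightarrow> bit" assume x: "x \<in> Fvec (Suc n)"
  show "x \<in> Fvec n \<union> (+) (\<lambda>i. of_bool (i = n)) ` Fvec n"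
  proof (cases "x n = 0")
    case True
    hence "x \<in> Fvec n" using x by (auto simp: Fvec_def) (metis Suc_leI le_neq_implies_less)
    thus ?thesis by simp
  next
    case False
    hence "x = (\<lambda>i. of_bool (i = n)) + x(n := 0)" "x(n := 0) \<in> Fvec n"
      using x by (auto simp: Fvec_def fun_eq_iff)
    thus ?thesis by blast
  qed
qed (auto simp: Fvec_def)

lemma Fvec_sub2: "sub2 (Fvec n)"
  by (auto simp: sub2_def Fvec_def fun_eq_iff)

lemma Fvec_finite_card: "finite (Fvec n) \<and> card (Fvec n) = 2 ^ n"
proof (induction n)
  case 0
  have "Fvec 0 = {0}" by (auto simp: Fvec_def fun_eq_iff)
  thus ?case by simp
next
  case (Suc n)
  have "(\<lambda>i. of_bool (i = n)) \<notin> Fvec n" by (auto simp: Fvec_def intro: exI[of _ n])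
  thus ?case using card_extend[OF Fvec_sub2 _ vec_self] Suc unfolding Fvec_Suc by simp
qed

lemmas Fvec_finite = Fvec_finite_card[THEN conjunct1]
  and Fvec_card = Fvec_finite_card[THEN conjunct2]

lemma Fvec_mono: "m \<le> n \<Longrightarrow> Fvec m \<subseteq> Fvec n"
  by (auto simp: Fvec_def)

text \<open>Trades dimension for order, so that later arguments only compare powers of two. A basis
  of \<open>U\<close> is finite because \<open>Fvec n\<close> is.\<close>

lemma is_subspace_iff: "is_subspace n d U \<longleftrightarrow> U \<subseteq> Fvec n \<and> sub2 U \<and> card U = 2 ^ d"
proof -
  have "card U = 2 ^ F2.dim U" if U: "U \<subseteq> Fvec n" "F2.subspace U"
  proof -
    obtain B where B: "B \<subseteq> U" "F2.independent B" "U \<subseteq> F2.span B" "card B = F2.dim U"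
      using F2.basis_exists by blast
    have "finite B" using B U Fvec_finite finite_subset by metis
    moreover have "F2.span B = U" using B U F2.span_minimal by blast
    ultimately show ?thesis using card_span B by metis
  qed
  thus ?thesis unfolding is_subspace_def subspace_iff_sub2 by auto
qed

section \<open>The quotient by the first \<open>m\<close> coordinates\<close>

definition shift :: "nat \<Rightarrow> (nat \<Rightarrow> bit) \<Rightarrow> nat \<Rightarrow> bit" where
  "shift m x = (\<lambda>i. x (i + m))"

text \<open>A section of the quotient map \<open>shift m\<close>, whose kernel is
  \<open>Fvec m\<close>.\<close>

definition lift :: "nat \<Rightarrow> (nat \<Rightarrow> bit) \<Rightarrow> nat \<Rightarrow> bit" where
  "lift m v = (\<lambda>i. if i < m then 0 else v (i - m))"

lemma shift_add: "shift m (x + y) = shift m x + shift m y"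
  and lift_add: "lift m (x + y) = lift m x + lift m y"
  by (auto simp: shift_def lift_def fun_eq_iff)

lemma shift_additive: "additive_on U (shift m)"
  by (auto simp: additive_on_def shift_add)

lemma shift_lift: "shift m (lift m v) = v"
  by (auto simp: shift_def lift_def)

lemma shift_Fvec: "x \<in> Fvec (m + k) \<Longrightarrow> shift m x \<in> Fvec k"
  by (auto simp: shift_def Fvec_def)

lemma lift_Fvec: "v \<in> Fvec k \<Longrightarrow> lift m v \<in> Fvec (m + k)"
  by (auto simp: lift_def Fvec_def)

lemma shift_eq_0_iff: "shift m x = 0 \<longleftrightarrow> x \<in> Fvec m"
proof
  assume *: "shift m x = 0"
  have "x i = 0" if "i \<ge> m" for i using fun_cong[OF *, of "i - m"] that by (simp add: shift_def)
  thus "x \<in> Fvec m" by (simp add: Fvec_def)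
qed (auto simp: shift_def Fvec_def fun_eq_iff)

lemma low_part: "x + lift m (shift m x) \<in> Fvec m"
  unfolding shift_eq_0_iff[symmetric] shift_add shift_lift by (rule vec_self)

text \<open>The fibre over \<open>v\<close> is the coset of \<open>Fvec m\<close> through
  \<open>lift m v\<close>, so it has \<open>2 ^ m\<close> elements.\<close>

lemma card_shift_vimage:
  assumes "A \<subseteq> Fvec k"
  shows "card {x \<in> Fvec (m + k). shift m x \<in> A} = 2 ^ m * card A"
proof -
  have sh: "shift m (y + lift m v) = v" if "y \<in> Fvec m" for y v
    using that by (simp add: shift_add shift_lift shift_eq_0_iff[THEN iffD2])
  have "bij_betw (\<lambda>(y, v). y + lift m v) (Fvec m \<times> A) {x \<in> Fvec (m + k). shift m x \<in> A}"
    unfolding bij_betw_def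
  proof
    show "inj_on (\<lambda>(y, v). y + lift m v) (Fvec m \<times> A)"
      by (rule inj_onI) (use sh in \<open>auto, (metis sh add_right_cancel)+\<close>)
    show "(\<lambda>(y, v). y + lift m v) ` (Fvec m \<times> A) = {x \<in> Fvec (m + k). shift m x \<in> A}"
    proof (intro Set.set_eqI iffI)
      fix x assume "x \<in> {x \<in> Fvec (m + k). shift m x \<in> A}"
      moreover have "x = (x + lift m (shift m x)) + lift m (shift m x)"
        by (simp add: add.assoc vec_self)
      ultimately show "x \<in> (\<lambda>(y, v). y + lift m v) ` (Fvec m \<times> A)"
        using low_part[of x m] by (intro image_eqI[of _ _ "(x + lift m (shift m x), shift m x)"]) auto
    next
      fix x assume "x \<in> (\<lambda>(y, v). y + lift m v) ` (Fvec m \<times> A)"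
      thus "x \<in> {x \<in> Fvec (m + k). shift m x \<in> A}"
        using assms sh Fvec_mono[of m "m + k"] lift_Fvec sub2_add[OF Fvec_sub2] by (auto 0 4)
    qed
  qed
  from bij_betw_same_card[OF this] show ?thesis by (simp add: card_cartesian_product Fvec_card)
qed

section \<open>The lifted Gabidulin code\<close>

text \<open>A linearized polynomial: the exponents 1, 2, 4 are the first three powers of the
  Frobenius map in characteristic two, which makes it additive there.\<close>

definition linpoly :: "'a::comm_ring_1 \<Rightarrow> 'a \<Rightarrow> 'a \<Rightarrow> 'a \<Rightarrow> 'a" where
  "linpoly a b c z = a * z + b * z ^ 2 + c * z ^ 4"

lemma linpoly_add: "linpoly a b c (x + y) = linpoly a b c x + linpoly a b c y" for a :: "bit alg_closure"
proof -
  have "(x + y) ^ 2 = x ^ 2 + y ^ 2" "(x + y) ^ 4 = x ^ 4 + y ^ 4"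
    using ac_add_pow[of x y 1] ac_add_pow[of x y 2] by (simp_all del: power2_sum)
  thus ?thesis unfolding linpoly_def by (simp only: distrib_left add_ac)
qed

lemma linpoly_add_coeffs:
  "linpoly (a + a') (b + b') (c + c') x = linpoly a b c x + linpoly a' b' c' x"
  by (simp add: linpoly_def algebra_simps)

lemma power_GF: assumes "x \<in> GF m" shows "x ^ n \<in> GF m"
proof -
  have "(x ^ n) ^ 2 ^ m = (x ^ 2 ^ m) ^ n" by (simp only: mult.commute flip: power_mult)
  thus ?thesis using assms by (simp add: GF_def)
qed

lemma linpoly_GF:
  "a \<in> GF m \<Longrightarrow> b \<in> GF m \<Longrightarrow> c \<in> GF m \<Longrightarrow> z \<in> GF m \<Longrightarrow> linpoly a b c z \<in> GF m"
  unfolding linpoly_def by (intro sub2_add[OF GF_sub2] GF_mult power_GF)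

text \<open>A nonzero polynomial of degree at most 4 has at most 4 roots.\<close>

lemma linpoly_zero:
  fixes a b c :: "'a::idom"
  assumes "card Z > 4" "\<And>z. z \<in> Z \<Longrightarrow> linpoly a b c z = 0"
  shows "a = 0 \<and> b = 0 \<and> c = 0"
proof (rule ccontr)
  assume n: "\<not> ?thesis"
  define p where "p = [:0, a, b, 0, c:]"
  have p0: "p \<noteq> 0" using n by (auto simp: p_def)
  have "degree p \<le> 4" by (simp add: p_def)
  moreover have "card {x. poly p x = 0} \<le> degree p" by (rule card_poly_roots_bound[OF p0])
  moreover have "poly p z = linpoly a b c z" for z
    by (simp add: p_def linpoly_def algebra_simps power2_eq_square power4_eq_xxxx)
  hence "card Z \<le> card {x. poly p x = 0}"
    using assms(2) by (intro card_mono poly_roots_finite p0) auto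
  ultimately show False using assms(1) by simp
qed

text \<open>Evaluation at three generators maps coefficient triples to value triples, two finite
  sets of the same size. It is injective because a polynomial vanishing at the generators vanishes
  on the eight elements of \<open>Z\<close>; hence it is surjective.\<close>

lemma linpoly_interpolation:
  assumes m: "m > 0" and Z: "sub2 Z" "Z \<subseteq> GF m" "card Z = 8"
    and z: "z1 \<in> Z" "z2 \<in> Z" "z3 \<in> Z"
    and gen: "\<forall>U. sub2 U \<and> z1 \<in> U \<and> z2 \<in> U \<and> z3 \<in> U \<longrightarrow> Z \<subseteq> U"
    and y: "y1 \<in> GF m" "y2 \<in> GF m" "y3 \<in> GF m"
  obtains a b c where "a \<in> GF m" "b \<in> GF m" "c \<in> GF m"
    "linpoly a b c z1 = y1" "linpoly a b c z2 = y2" "linpoly a b c z3 = y3"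
proof -
  let ?K = "GF m \<times> GF m \<times> GF m"
  define F where "F = (\<lambda>(a, b, c). (linpoly a b c z1, linpoly a b c z2, linpoly a b c z3))"
  have "inj_on F ?K"
  proof (rule inj_onI)
    fix s t assume "F s = F t"
    moreover obtain a b c a' b' c' where st: "s = (a, b, c)" "t = (a', b', c')"
      by (metis surj_pair)
    ultimately have eq: "F (a, b, c) = F (a', b', c')" by simp
    \<comment> \<open>In characteristic two the sum of the coefficients is their difference. The
      zeros of the resulting polynomial form a subgroup, which contains \<open>Z\<close> once it
      contains the generators.\<close>
    have "sub2 {z \<in> GF m. linpoly (a + a') (b + b') (c + c') z \<in> {0}}"
      by (rule sub2_vimage[OF GF_sub2 _ sub2_singleton]) (simp add: additive_on_def linpoly_add)
    moreover have "linpoly (a + a') (b + b') (c + c') z \<in> {0}" if "z \<in> {z1, z2, z3}" for z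
      using eq that by (auto simp: F_def linpoly_add_coeffs ac_self)
    ultimately have "Z \<subseteq> {z \<in> GF m. linpoly (a + a') (b + b') (c + c') z \<in> {0}}"
      using z Z(2) by (intro gen[rule_format]) auto
    hence "a + a' = 0 \<and> b + b' = 0 \<and> c + c' = 0"
      using Z(3) by (intro linpoly_zero[of Z]) auto
    thus "s = t" unfolding st by (metis ac_self add_right_cancel)
  qed
  moreover have "finite ?K" using GF_card[OF m] by simp
  moreover have "F ` ?K \<subseteq> ?K" using z Z(2) by (auto simp: F_def intro!: linpoly_GF)
  ultimately have "F ` ?K = ?K" by (metis endo_inj_surj)
  hence "(y1, y2, y3) \<in> F ` ?K" using y by simp
  thus ?thesis using that by (auto simp: F_def)
qed

text \<open>A subspace \<open>W\<close> meeting \<open>Fvec m\<close> trivially is the graph of an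
  additive map on its image under \<open>shift m\<close>. Transported to the field, this map is
  defined on eight elements and agrees there with a linearized polynomial, whose graph is a codeword
  containing \<open>W\<close>.\<close>

lemma lifted_code_covers:
  assumes "0 < k" "k \<le> m"
  obtains M where "finite M" "card M \<le> 2 ^ (3 * m)" "\<And>X. X \<in> M \<Longrightarrow> is_subspace (m + k) k X"
    "\<And>W. is_subspace (m + k) 3 W \<Longrightarrow> W \<inter> Fvec m = {0} \<Longrightarrow> \<exists>X\<in>M. W \<subseteq> X"
proof -
  have m: "m > 0" using assms by simp
  note K = GF_card[OF m]
  \<comment> \<open>\<open>k \<le> m\<close> leaves room to embed the quotient \<open>Fvec k\<close>
    in the field as a subgroup \<open>E\<close>.\<close>
  obtain E where E: "sub2 E" "E \<subseteq> GF m" "card E = 2 ^ k"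
    using sub2_between[OF sub2_singleton GF_sub2 K(1), of 0 m k] K assms sub2_zero[OF GF_sub2] by auto
  have finE: "finite E" using E K finite_subset by blast
  obtain e where e: "additive_on (Fvec k) e" "bij_betw e (Fvec k) E"
    using additive_bij_exists[OF Fvec_sub2 E(1) Fvec_finite finE] E Fvec_card by metis
  obtain g where g: "additive_on (GF m) g" "bij_betw g (GF m) (Fvec m)"
    using additive_bij_exists[OF GF_sub2 Fvec_sub2 K(1) Fvec_finite] K Fvec_card by metis
  have eE: "e v \<in> GF m" if "v \<in> Fvec k" for v using that e E bij_betwE by blast
  \<comment> \<open>The point of the graph above \<open>v\<close>: its low coordinates are the value
    of the polynomial at \<open>e v\<close>, its high coordinates are \<open>v\<close>.\<close>
  define h where "h = (\<lambda>(a, b, c) v. g (linpoly a b c (e v)) + lift m v)"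
  let ?K = "GF m \<times> GF m \<times> GF m"
  define M where "M = (\<lambda>t. h t ` Fvec k) ` ?K"
  have hadd: "additive_on (Fvec k) (h t)" if "t \<in> ?K" for t
    using that e(1) g(1) by (auto simp: additive_on_def h_def linpoly_add lift_add eE linpoly_GF)
  have glow: "g (linpoly a b c (e v)) \<in> Fvec m" if "(a, b, c) \<in> ?K" "v \<in> Fvec k" for a b c v
    using that g(2) bij_betwE linpoly_GF eE by (metis mem_Sigma_iff)
  have hsh: "shift m (h t v) = v" if "t \<in> ?K" "v \<in> Fvec k" for t v
    using that glow by (auto simp: h_def shift_add shift_lift shift_eq_0_iff[THEN iffD2])
  show ?thesis
  proof (rule that)
    show "finite M" unfolding M_def using K by simp
    have "card M \<le> card ?K" unfolding M_def using K by (intro card_image_le) simp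
    also have "\<dots> = 2 ^ (3 * m)" using K by (simp add: card_cartesian_product flip: power_add)
    finally show "card M \<le> 2 ^ (3 * m)" .
  next
    fix X assume "X \<in> M"
    then obtain t where t: "t \<in> ?K" "X = h t ` Fvec k" by (auto simp: M_def)
    have "inj_on (h t) (Fvec k)" by (rule inj_onI) (metis hsh t(1))
    hence "card X = 2 ^ k" using t Fvec_card by (simp add: card_image)
    moreover have "sub2 X" using t hadd sub2_image Fvec_sub2 by blast
    moreover have "X \<subseteq> Fvec (m + k)" using t glow Fvec_mono[of m "m + k"] lift_Fvec
      by (auto simp: h_def intro!: sub2_add[OF Fvec_sub2])
    ultimately show "is_subspace (m + k) k X" by (simp add: is_subspace_iff)
  next
    fix W assume "is_subspace (m + k) 3 W" and W0: "W \<inter> Fvec m = {0}"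
    hence W: "W \<subseteq> Fvec (m + k)" "sub2 W" "card W = 8" by (auto simp: is_subspace_iff)
    define z where "z w = e (shift m w)" for w
    have zadd: "additive_on W z" unfolding z_def
      by (rule additive_on_comp[OF shift_additive e(1)]) (use W shift_Fvec in auto)
    have shW: "shift m w \<in> Fvec k" if "w \<in> W" for w using that W shift_Fvec by blast
    have zinj: "inj_on z W"
    proof (rule additive_on_inj_on[OF W(2) zadd])
      fix w assume w: "w \<in> W" "z w = 0"
      have "e 0 = 0" using additive_on_zero[OF Fvec_sub2 e(1)] .
      hence "shift m w = 0" using w shW[OF w(1)] e(2) sub2_zero[OF Fvec_sub2]
        unfolding z_def by (metis bij_betw_imp_inj_on inj_on_def)
      thus "w = 0" using W0 w by (auto simp: shift_eq_0_iff)
    qed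
    obtain w1 w2 w3 where w: "w1 \<in> W" "w2 \<in> W" "w3 \<in> W"
      and gen: "\<And>U. sub2 U \<Longrightarrow> w1 \<in> U \<Longrightarrow> w2 \<in> U \<Longrightarrow> w3 \<in> U \<Longrightarrow> W \<subseteq> U"
      using sub2_eight_generated[OF W(2,3)] by blast
    \<comment> \<open>The low part of \<open>w\<close> read as a field element, which is the value
      to be interpolated at \<open>z w\<close>.\<close>
    define r where "r w = inv_into (GF m) g (w + lift m (shift m w))" for w
    have gr: "g (r x) = x + lift m (shift m x)" "r x \<in> GF m" for x
      using g(2) low_part[of x m] unfolding r_def
      by (auto simp: bij_betw_def f_inv_into_f inv_into_into)
    have genZ: "\<forall>U. sub2 U \<and> z w1 \<in> U \<and> z w2 \<in> U \<and> z w3 \<in> U \<longrightarrow> z ` W \<subseteq> U"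
      using gen[OF sub2_vimage[OF W(2) zadd]] w by blast
    have "sub2 (z ` W)" "z ` W \<subseteq> GF m" "card (z ` W) = 8"
      using sub2_image[OF W(2) zadd] shW eE W zinj by (auto simp: z_def[abs_def] card_image)
    from linpoly_interpolation[OF m this imageI[OF w(1)] imageI[OF w(2)] imageI[OF w(3)] genZ gr(2) gr(2) gr(2)]
    obtain a b c where abc: "a \<in> GF m" "b \<in> GF m" "c \<in> GF m"
      "linpoly a b c (z w1) = r w1" "linpoly a b c (z w2) = r w2" "linpoly a b c (z w3) = r w3"
      by blast
    \<comment> \<open>The discrepancy between \<open>w\<close> and the graph point above its image.
      It is additive, so it vanishes on \<open>W\<close> as soon as it vanishes at the three
      generators.\<close>
    let ?d = "\<lambda>w. h (a, b, c) (shift m w) + w"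
    have t: "(a, b, c) \<in> ?K" using abc by simp
    have "additive_on W (\<lambda>w. h (a, b, c) (shift m w))"
      by (rule additive_on_comp[OF shift_additive hadd[OF t]]) (use shW in auto)
    hence "additive_on W ?d" by (simp add: additive_on_def algebra_simps)
    note vim = sub2_vimage[OF W(2) this sub2_singleton]
    have "?d w' = 0" if "linpoly a b c (z w') = r w'" "w' \<in> W" for w'
      using that gr(1)[of w'] unfolding h_def z_def by (simp add: add.assoc vec_self)
    hence "W \<subseteq> {w' \<in> W. ?d w' \<in> {0}}"
      using w abc by (intro gen[OF vim]) auto
    hence "w' = h (a, b, c) (shift m w')" if "w' \<in> W" for w'
      using that vec_self[of w'] by (metis (mono_tags, lifting) add_right_cancel mem_Collect_eq singletonD subsetD)
    hence "W \<subseteq> h (a, b, c) ` Fvec k" using shW by blast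
    thus "\<exists>X\<in>M. W \<subseteq> X" using t by (auto simp: M_def)
  qed
qed

section \<open>Points and lines\<close>

text \<open>If the span of 1 and \<open>a\<close> contains \<open>a ^ 2\<close>, it is closed under
  squaring, and squaring twice fixes \<open>a\<close>. The value \<open>a ^ 2 = 1\<close> forces
  \<open>a = 1\<close>, since then \<open>(1 + a) ^ 2 = 0\<close>.\<close>

lemma GF_2I:
  assumes "a ^ 2 \<in> {0, 1, a, 1 + a}" shows "a \<in> GF 2"
proof -
  have 4: "a ^ 4 = (a ^ 2) ^ 2" using power_mult[of a 2 2] by simp
  have sq: "(1 + a) ^ 2 = 1 + a ^ 2" using ac_add_pow[of 1 a 1] by (simp del: power2_sum)
  have "a ^ 4 = a"
  proof (cases "a ^ 2 = 1")
    case True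
    hence "(1 + a) ^ 2 = 0" using sq ac_self by simp
    hence "1 + a = 0" by (simp del: power2_sum)
    hence "a = 1" by (metis ac_self add_left_cancel)
    thus ?thesis by simp
  next
    case False
    have "1 + (1 + a) = a" by (simp add: self_add_cancel_left ac_self)
    hence "a ^ 2 = 0 \<or> a ^ 2 = a \<or> a ^ 2 = 1 + a \<and> (1 + a) ^ 2 = a"
      using False assms sq by force
    thus ?thesis by (elim disjE conjE) (simp, metis 4, metis 4)
  qed
  thus ?thesis by (simp add: GF_def)
qed

text \<open>Multiplying the line spanned by \<open>1\<close> and \<open>\<alpha>\<close> by \<open>p\<close> gives distinct lines for distinct points
  \<open>p\<close>, provided that \<open>\<alpha>\<close> does not lie in the field with four elements.\<close>
lemma points_to_lines_GF:
  assumes "k \<ge> 3"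
  obtains \<tau> where "inj_on \<tau> (GF k - {0})"
    "\<And>p. p \<in> GF k - {0} \<Longrightarrow> \<tau> p \<subseteq> GF k \<and> sub2 (\<tau> p) \<and> card (\<tau> p) = 4 \<and> p \<in> \<tau> p"
proof -
  \<comment> \<open>Only the orders are compared, because \<open>GF 2\<close> need not lie inside
    \<open>GF k\<close>.\<close>
  have "card (GF 2) < card (GF k)"
    using GF_card(2)[of 2] GF_card(2)[of k] assms power_strict_increasing[of 2 k "2::nat"] by simp
  then obtain \<alpha> where \<alpha>: "\<alpha> \<in> GF k" "\<alpha> \<notin> GF 2"
    using GF_card(1)[of 2] by (metis card_mono leD subsetI zero_less_numeral)
  define \<tau> where "\<tau> p = {0, p} \<union> (+) (\<alpha> * p) ` {0, p}" for p
  have "0 \<in> GF 2" "1 \<in> GF 2" by (auto simp: GF_def)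
  hence \<alpha>1: "\<alpha> \<noteq> 0" "\<alpha> \<noteq> 1" using \<alpha> by auto
  have out: "\<alpha> * p \<notin> {0, p}" if "p \<noteq> 0" for p using that \<alpha>1 by auto
  show ?thesis
  proof (rule that)
    fix p assume p: "p \<in> GF k - {0}"
    have "sub2 (\<tau> p)" unfolding \<tau>_def by (intro sub2_extend sub2_doubleton ac_self)
    moreover have "card (\<tau> p) = 4" unfolding \<tau>_def
      using card_extend[OF sub2_doubleton[OF ac_self] _ ac_self out] p by simp
    moreover have "\<tau> p \<subseteq> GF k" unfolding \<tau>_def
      using p \<alpha> GF_mult sub2_zero[OF GF_sub2] sub2_add[OF GF_sub2] by auto
    ultimately show "\<tau> p \<subseteq> GF k \<and> sub2 (\<tau> p) \<and> card (\<tau> p) = 4 \<and> p \<in> \<tau> p"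
      by (simp add: \<tau>_def)
  next
    show "inj_on \<tau> (GF k - {0})"
    proof (rule inj_onI, rule ccontr)
      fix p q assume pq: "p \<in> GF k - {0}" "q \<in> GF k - {0}" "\<tau> p = \<tau> q" "p \<noteq> q"
      have mem: "x \<in> \<tau> p \<longleftrightarrow> x \<in> (\<lambda>c. c * p) ` {0, 1, \<alpha>, 1 + \<alpha>}" for x
        by (auto simp: \<tau>_def distrib_right add.commute)
      \<comment> \<open>Both \<open>q\<close> and \<open>\<alpha> * q\<close> lie on the line of
        \<open>p\<close>. Dividing by \<open>p\<close> shows that \<open>\<alpha> ^ 2\<close> lies
        in the span of 1 and \<open>\<alpha>\<close>, contrary to the choice of
        \<open>\<alpha>\<close>.\<close>
      have "q \<in> \<tau> p" "\<alpha> * q \<in> \<tau> p" unfolding pq(3) by (auto simp: \<tau>_def)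
      then obtain c d where c: "c \<in> {0, 1, \<alpha>, 1 + \<alpha>}" "q = c * p"
          and d: "d \<in> {0, 1, \<alpha>, 1 + \<alpha>}" "\<alpha> * q = d * p"
        unfolding mem by blast
      \<comment> \<open>The coefficients 0 and 1 are excluded by \<open>q \<noteq> 0\<close> and
        \<open>q \<noteq> p\<close>.\<close>
      have cc: "c = \<alpha> \<or> c = 1 + \<alpha>" using c pq by auto
      have "\<alpha> * c = d" using c d pq by simp
      moreover have "\<alpha> * (1 + \<alpha>) = \<alpha> + \<alpha> ^ 2" by (simp add: algebra_simps power2_eq_square)
      ultimately have "\<alpha> ^ 2 = d \<or> \<alpha> ^ 2 = \<alpha> + d"
        using cc self_add_cancel_left[OF ac_self, of \<alpha>] by (auto simp: power2_eq_square)
      moreover have "\<alpha> + d \<in> {0, 1, \<alpha>, 1 + \<alpha>}"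
        using d(1) ac_self[of \<alpha>] by (auto simp: add.commute add.left_commute)
      ultimately have "\<alpha> ^ 2 \<in> {0, 1, \<alpha>, 1 + \<alpha>}" using d(1) by metis
      thus False using GF_2I \<alpha> by blast
    qed
  qed
qed

text \<open>Only the additive structure enters the conclusion, so the map found in the field is
  transported along an additive bijection onto \<open>Fvec k\<close>.\<close>

lemma points_to_lines:
  assumes "k \<ge> 3"
  obtains \<tau> where "inj_on \<tau> (Fvec k - {0})"
    "\<And>p. p \<in> Fvec k - {0} \<Longrightarrow> \<tau> p \<subseteq> Fvec k \<and> sub2 (\<tau> p) \<and> card (\<tau> p) = 4 \<and> p \<in> \<tau> p"
proof -
  have k0: "k > 0" using assms by simp
  obtain \<tau> where \<tau>: "inj_on \<tau> (GF k - {0})"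
    "\<And>p. p \<in> GF k - {0} \<Longrightarrow> \<tau> p \<subseteq> GF k \<and> sub2 (\<tau> p) \<and> card (\<tau> p) = 4 \<and> p \<in> \<tau> p"
    using points_to_lines_GF[OF assms] by blast
  obtain g where g: "additive_on (GF k) g" "bij_betw g (GF k) (Fvec k)"
    using additive_bij_exists[OF GF_sub2 Fvec_sub2 GF_card(1)[OF k0] Fvec_finite] GF_card(2)[OF k0] Fvec_card by metis
  define f where "f = inv_into (GF k) g"
  have f: "f v \<in> GF k" "g (f v) = v" if "v \<in> Fvec k" for v
    using that g(2) by (auto simp: f_def bij_betw_def inv_into_into f_inv_into_f)
  have g0: "g 0 = 0" using additive_on_zero[OF GF_sub2 g(1)] .
  have f': "f v \<in> GF k - {0}" if "v \<in> Fvec k - {0}" for v using that f[of v] g0 by auto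
  have ginj: "inj_on g (GF k)" using g(2) bij_betw_def by blast
  show ?thesis
  proof (rule that[of "\<lambda>v. g ` \<tau> (f v)"])
    fix p assume p: "p \<in> Fvec k - {0}"
    note t = \<tau>(2)[OF f'[OF p]]
    have "sub2 (g ` \<tau> (f p))" using t sub2_image additive_on_subset[OF g(1)] by blast
    moreover have "card (g ` \<tau> (f p)) = 4" using t card_image inj_on_subset[OF ginj] by metis
    moreover have "g ` \<tau> (f p) \<subseteq> Fvec k" using t g(2) by (auto simp: bij_betw_def)
    moreover have "p \<in> g ` \<tau> (f p)" using t f(2)[of p] p by (metis DiffD1 imageI)
    ultimately show "g ` \<tau> (f p) \<subseteq> Fvec k \<and> sub2 (g ` \<tau> (f p)) \<and> card (g ` \<tau> (f p)) = 4 \<and> p \<in> g ` \<tau> (f p)"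
      by blast
  next
    show "inj_on (\<lambda>v. g ` \<tau> (f v)) (Fvec k - {0})"
    proof (rule inj_onI)
      fix p q assume pq: "p \<in> Fvec k - {0}" "q \<in> Fvec k - {0}" "g ` \<tau> (f p) = g ` \<tau> (f q)"
      have "\<tau> (f p) = \<tau> (f q)"
        using inj_on_image_eq_iff[OF ginj] \<tau>(2)[OF f'[OF pq(1)]] \<tau>(2)[OF f'[OF pq(2)]] pq(3) by blast
      hence "f p = f q" using \<tau>(1) f' pq(1,2) by (meson inj_onD)
      thus "p = q" using f(2) pq by (metis DiffD1)
    qed
  qed
qed

section \<open>Counting lines\<close>

definition lines :: "nat \<Rightarrow> (nat \<Rightarrow> bit) set set" where
  "lines k = {T. T \<subseteq> Fvec k \<and> sub2 T \<and> card T = 4}"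

lemma finite_lines: "finite (lines k)"
  by (rule finite_subset[of _ "Pow (Fvec k)"]) (auto simp: lines_def Fvec_finite)

lemma card_off_diagonal:
  assumes "finite A" shows "card {(v, w). v \<in> A \<and> w \<in> A \<and> v \<noteq> w} = card A * (card A - 1)"
proof -
  have "{(v, w). v \<in> A \<and> w \<in> A \<and> v \<noteq> w} = (SIGMA v:A. A - {v})" by auto
  thus ?thesis using assms by (simp add: card_SigmaI)
qed

text \<open>Double counting of ordered pairs of distinct nonzero vectors: each line contains six of
  them, and a pair determines its line.\<close>

lemma card_lines: "card (lines k) \<le> gauss2 k"
proof -
  define P where "P T = {(v, w). v \<in> T - {0} \<and> w \<in> T - {0} \<and> v \<noteq> w}" for T :: "(nat \<Rightarrow> bit) set"
  have line: "finite T" "0 \<in> T" if "T \<in> lines k" for T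
    using that Fvec_finite finite_subset sub2_zero by (auto simp: lines_def)
  have "card (P T) = 6" if "T \<in> lines k" for T
    unfolding P_def using that line[OF that] by (subst card_off_diagonal) (auto simp: lines_def)
  hence "6 * card (lines k) = card (SIGMA T:lines k. P T)"
    using finite_lines line by (subst card_SigmaI) (auto simp: P_def intro: finite_subset[of _ "_ \<times> _"])
  also have "\<dots> = card (snd ` (SIGMA T:lines k. P T))"
  proof (rule card_image[symmetric], rule inj_onI, clarsimp)
    fix T T' v w assume "T \<in> lines k" "T' \<in> lines k" "(v, w) \<in> P T" "(v, w) \<in> P T'"
    hence "T = {0, v, w, v + w}" "T' = {0, v, w, v + w}"
      using sub2_four[of _ v w] unfolding P_def lines_def by blast+
    thus "T = T'" by simp
  qed
  also have "\<dots> \<le> card (P (Fvec k))"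
    by (rule card_mono) (auto simp: P_def lines_def Fvec_finite intro: finite_subset[of _ "Fvec k \<times> Fvec k"])
  also have "\<dots> = (2 ^ k - 1) * (2 ^ k - 2)"
    unfolding P_def using sub2_zero[OF Fvec_sub2, of k]
    by (subst card_off_diagonal) (auto simp: Fvec_finite Fvec_card)
  finally have le: "6 * card (lines k) \<le> (2 ^ k - 1) * (2 ^ k - 2)" .
  show ?thesis
  proof (cases k)
    case 0 thus ?thesis using le by simp
  next
    case (Suc j)
    \<comment> \<open>Taking out the factor 2 turns 6 into the 3 in the denominator of the Gaussian
      coefficient.\<close>
    have "(2::nat) ^ k - 2 = 2 * (2 ^ j - 1)" by (simp add: Suc right_diff_distrib')
    hence "3 * card (lines k) \<le> (2 ^ k - 1) * (2 ^ j - 1)" using le by (simp add: mult.commute)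
    thus ?thesis unfolding gauss2_def Suc by simp
  qed
qed

text \<open>The \<open>LEAST\<close> is meaningful only if some design exists; the set of all
  \<open>k\<close>-dimensional subspaces is one.\<close>

lemma covering_number_attained:
  assumes "r \<le> k" "k \<le> n"
  obtains D where "is_covering_design n k r D" "card D = covering_number n k r"
proof -
  let ?D = "{X. is_subspace n k X}"
  have "finite ?D"
    by (rule finite_subset[of _ "Pow (Fvec n)"]) (auto simp: is_subspace_iff Fvec_finite)
  moreover have "\<exists>X\<in>?D. W \<subseteq> X" if "is_subspace n r W" for W
    using sub2_between[OF _ Fvec_sub2 Fvec_finite _ _ Fvec_card assms, of W] that
    unfolding is_subspace_iff mem_Collect_eq by blast
  ultimately have "is_covering_design n k r ?D" unfolding is_covering_design_def by blast
  hence "\<exists>m D. is_covering_design n k r D \<and> card D = m" by blast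
  from LeastI_ex[OF this] show ?thesis using that unfolding covering_number_def by blast
qed

lemma covering_number_le: "is_covering_design n k r D \<Longrightarrow> covering_number n k r \<le> card D"
  unfolding covering_number_def by (rule Least_le) blast

section \<open>The covering design\<close>

definition preimg :: "nat \<Rightarrow> nat \<Rightarrow> (nat \<Rightarrow> bit) set \<Rightarrow> (nat \<Rightarrow> bit) set" where
  "preimg m k A = {x \<in> Fvec (m + k). shift m x \<in> A}"

lemma preimg_sub2: "sub2 A \<Longrightarrow> sub2 (preimg m k A)"
  unfolding preimg_def by (rule sub2_vimage[OF Fvec_sub2 shift_additive])

lemma preimg_finite: "finite (preimg m k A)"
  unfolding preimg_def by (rule finite_subset[OF _ Fvec_finite]) auto

lemma preimg_zero: "preimg m k {0} = Fvec m"
  using Fvec_mono[of m "m + k"] by (auto simp: preimg_def shift_eq_0_iff)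

lemma card_preimg: "A \<subseteq> Fvec k \<Longrightarrow> card (preimg m k A) = 2 ^ m * card A"
  unfolding preimg_def by (rule card_shift_vimage)

text \<open>The chains \<open>U0\<close>, \<open>U1\<close>, \<open>Fvec (m + 2)\<close> and
  \<open>Fvec m\<close>, \<open>preimg m k {0, p}\<close>, \<open>preimg m k T\<close> have the same
  orders \<open>2 ^ m\<close>, \<open>2 ^ (m + 1)\<close>, \<open>2 ^ (m + 2)\<close>, so an
  additive bijection can be built step by step along them.\<close>

lemma line_iso:
  assumes U0: "is_subspace (m + 2) m U0" and U1: "is_subspace (m + 2) (m + 1) U1" and "U0 \<subseteq> U1"
    and T: "T \<in> lines k" and p: "p \<in> T - {0}"
  shows "\<exists>f. additive_on (Fvec (m + 2)) f \<and> bij_betw f (Fvec (m + 2)) (preimg m k T) \<and>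
    f ` U1 = preimg m k {0, p} \<and> f ` U0 = Fvec m"
proof -
  have U: "U0 \<subseteq> Fvec (m + 2)" "sub2 U0" "card U0 = 2 ^ m" "U1 \<subseteq> Fvec (m + 2)" "sub2 U1" "card U1 = 2 ^ (m + 1)"
    using U0 U1 by (auto simp: is_subspace_iff)
  have fin: "finite U0" "finite U1" using U finite_subset Fvec_finite by metis+
  have Tk: "T \<subseteq> Fvec k" "sub2 T" "card T = 4" using T by (auto simp: lines_def)
  have sub: "{0, p} \<subseteq> T" using p sub2_zero[OF Tk(2)] by auto
  have sp: "sub2 {0, p}" by (rule sub2_doubleton[OF vec_self])
  have c1: "card (preimg m k {0, p}) = 2 ^ (m + 1)"
    using card_preimg[OF subset_trans[OF sub Tk(1)], of m] p by simp
  have c2: "card (preimg m k T) = 2 ^ (m + 2)" using card_preimg[OF Tk(1)] Tk by simp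
  obtain f0 where f0: "additive_on U0 f0" "bij_betw f0 U0 (Fvec m)"
    using additive_bij_exists[OF U(2) Fvec_sub2 fin(1) Fvec_finite] U Fvec_card by metis
  have "Fvec m \<subseteq> preimg m k {0, p}" unfolding preimg_zero[of m k, symmetric] by (auto simp: preimg_def)
  then obtain f1 where f1: "additive_on U1 f1" "bij_betw f1 U1 (preimg m k {0, p})" "\<forall>x\<in>U0. f1 x = f0 x"
    using additive_bij_extends[OF U(2) Fvec_sub2 f0 U(5) preimg_sub2[OF sp] fin(2) preimg_finite _ assms(3)]
      c1 U by metis
  have "preimg m k {0, p} \<subseteq> preimg m k T" using sub by (auto simp: preimg_def)
  then obtain f2 where f2: "additive_on (Fvec (m + 2)) f2" "bij_betw f2 (Fvec (m + 2)) (preimg m k T)" "\<forall>x\<in>U1. f2 x = f1 x"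
    using additive_bij_extends[OF U(5) preimg_sub2[OF sp] f1(1,2) Fvec_sub2 preimg_sub2[OF Tk(2)] Fvec_finite preimg_finite _ U(4)]
      c2 Fvec_card by metis
  have "f2 ` U1 = f1 ` U1" "f2 ` U0 = f0 ` U0"
    using f2(3) f1(3) assms(3) by (auto intro!: image_cong)
  hence "f2 ` U1 = preimg m k {0, p}" "f2 ` U0 = Fvec m"
    using bij_betw_imp_surj_on[OF f0(2)] bij_betw_imp_surj_on[OF f1(2)] by simp_all
  thus ?thesis using f2(1,2) by blast
qed

lemma is_subspace_image:
  assumes "is_subspace n d U" "additive_on (Fvec n) f" "inj_on f (Fvec n)" "f ` Fvec n \<subseteq> Fvec n'"
  shows "is_subspace n' d (f ` U)"
proof -
  have U: "U \<subseteq> Fvec n" "sub2 U" "card U = 2 ^ d" using assms(1) by (auto simp: is_subspace_iff)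
  thus ?thesis unfolding is_subspace_iff
    using sub2_image[OF U(2) additive_on_subset[OF assms(2) U(1)]] assms(4)
      card_image[OF inj_on_subset[OF assms(3) U(1)]] by auto
qed

lemma is_subspace_pullback:
  assumes "is_subspace n' d W" "additive_on (Fvec n) f" "inj_on f (Fvec n)" "W \<subseteq> f ` Fvec n"
  shows "is_subspace n d {x \<in> Fvec n. f x \<in> W}" "f ` {x \<in> Fvec n. f x \<in> W} = W"
proof -
  show im: "f ` {x \<in> Fvec n. f x \<in> W} = W" using assms(4) by auto
  have W: "sub2 W" "card W = 2 ^ d" using assms(1) by (auto simp: is_subspace_iff)
  have "inj_on f {x \<in> Fvec n. f x \<in> W}" by (rule inj_on_subset[OF assms(3)]) auto
  from card_image[OF this] have "card {x \<in> Fvec n. f x \<in> W} = 2 ^ d" using im W by simp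
  thus "is_subspace n d {x \<in> Fvec n. f x \<in> W}"
    using sub2_vimage[OF Fvec_sub2 assms(2) W(1)] by (auto simp: is_subspace_iff)
qed

text \<open>\<open>W\<close> maps onto \<open>A\<close>, so \<open>W\<close> and
  \<open>Fvec m\<close> together generate \<open>preimg m k A\<close>. A subspace \<open>U\<close>
  containing the pullbacks of both would be the whole space, which its order forbids.\<close>

lemma pullback_not_in_hyperplane:
  assumes f: "additive_on (Fvec (m + 2)) f" "bij_betw f (Fvec (m + 2)) (preimg m k A)" "A = shift m ` W"
    and U0: "f ` U0 = Fvec m" "U0 \<subseteq> U" and U: "is_subspace (m + 2) (m + 1) U"
    and W: "W \<subseteq> Fvec (m + k)"
  shows "\<not> {x \<in> Fvec (m + 2). f x \<in> W} \<subseteq> U"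
proof
  assume sub: "{x \<in> Fvec (m + 2). f x \<in> W} \<subseteq> U"
  have U': "U \<subseteq> Fvec (m + 2)" "sub2 U" "card U = 2 ^ (m + 1)" using U by (auto simp: is_subspace_iff)
  have "x \<in> U" if x: "x \<in> Fvec (m + 2)" for x
  proof -
    have "f x \<in> preimg m k A" using f(2) x bij_betwE by blast
    then obtain w where w: "w \<in> W" "shift m (f x) = shift m w" by (auto simp: preimg_def f(3))
    have "w \<in> preimg m k A" using w W by (auto simp: preimg_def f(3))
    hence "w \<in> f ` Fvec (m + 2)" using bij_betw_imp_surj_on[OF f(2)] by simp
    then obtain w' where w': "w' \<in> Fvec (m + 2)" "f w' = w" by blast
    have "shift m (f x + w) = 0" using w by (simp add: shift_add vec_self)
    hence "f x + w \<in> f ` U0" by (simp add: U0 shift_eq_0_iff)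
    then obtain u where u: "u \<in> U0" "f x + w = f u" by auto
    have "f (x + w') = f u" using additive_onD[OF f(1)] x w' u by simp
    moreover have "x + w' \<in> Fvec (m + 2)" "u \<in> Fvec (m + 2)"
      using sub2_add[OF Fvec_sub2 x w'(1)] u U0 U' by auto
    ultimately have "x + w' = u" using f(2) by (meson bij_betw_imp_inj_on inj_onD)
    hence "x + w' \<in> U" "w' \<in> U" using u U0 sub w w' by auto
    hence "x + w' + w' \<in> U" using U' sub2_add by blast
    thus ?thesis by (simp add: add.assoc vec_self)
  qed
  hence "card (Fvec (m + 2)) \<le> card U"
    using U' Fvec_finite by (intro card_mono) (auto intro: finite_subset)
  thus False using U' by (simp add: Fvec_card)
qed

text \<open>Inclusion-exclusion: three pairwise intersections are subtracted and the triple one is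
  added back, all equal to \<open>D\<close>. Integers avoid truncated subtraction.\<close>

lemma card_Un3_common_Int:
  assumes "finite A" "finite B" "finite C" "A \<inter> B = D" "A \<inter> C = D" "B \<inter> C = D"
  shows "int (card (A \<union> B \<union> C)) = int (card A) + int (card B) + int (card C) - 2 * int (card D)"
proof -
  have "(A \<union> B) \<inter> C = D" using assms by auto
  thus ?thesis using card_Un_Int[of A B] card_Un_Int[of "A \<union> B" C] assms by simp
qed

theorem mainTheorem14:
  fixes n k :: nat
    and S :: "(nat \<Rightarrow> bit) set set"
    and U0 U1 U2 U3 :: "(nat \<Rightarrow> bit) set"
  assumes "6 \<le> 2 * k" and "2 * k \<le> n"
    and "is_covering_design (n - k + 2) k 3 S"
    and "is_subspace (n - k + 2) (n - k) U0"
    and "is_subspace (n - k + 2) (n - k + 1) U1"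
    and "is_subspace (n - k + 2) (n - k + 1) U2"
    and "is_subspace (n - k + 2) (n - k + 1) U3"
    and "U1 \<inter> U2 = U0" and "U1 \<inter> U3 = U0" and "U2 \<inter> U3 = U0"
    and "card {X\<in>S. X \<subseteq> U1} \<le> card {X\<in>S. X \<subseteq> U2}"
    and "card {X\<in>S. X \<subseteq> U2} \<le> card {X\<in>S. X \<subseteq> U3}"
  shows "int (covering_number n k 3) \<le>
     2 ^ (3 * (n - k))
     + int (gauss2 k) * (int (card S) - int (card {X\<in>S. X \<subseteq> U1})
          - int (card {X\<in>S. X \<subseteq> U2}) - int (card {X\<in>S. X \<subseteq> U3})
          + 2 * int (card {X\<in>S. X \<subseteq> U0}))
     + (2 ^ k - 1) * (int (card {X\<in>S. X \<subseteq> U1}) - int (card {X\<in>S. X \<subseteq> U0}))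
     + int (covering_number (n - k) k 3)"
proof -
  define m where "m = n - k"
  have n: "n = m + k" and k: "3 \<le> k" "0 < k" "k \<le> m" using assms(1,2) by (auto simp: m_def)
  note S = assms(3)[folded m_def] and U0 = assms(4)[folded m_def] and U1 = assms(5)[folded m_def]
    and U2 = assms(6)[folded m_def] and U3 = assms(7)[folded m_def]
  have inc: "U0 \<subseteq> U1" "U0 \<subseteq> U2" "U0 \<subseteq> U3" using assms(8-10) by auto
  have finS: "finite S" and dimS: "\<And>X. X \<in> S \<Longrightarrow> is_subspace (m + 2) k X"
    and covS: "\<And>W. is_subspace (m + 2) 3 W \<Longrightarrow> \<exists>X\<in>S. W \<subseteq> X"
    using S by (auto simp: is_covering_design_def)
  obtain M where M: "finite M" "card M \<le> 2 ^ (3 * m)" "\<And>X. X \<in> M \<Longrightarrow> is_subspace (m + k) k X"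
    "\<And>W. is_subspace (m + k) 3 W \<Longrightarrow> W \<inter> Fvec m = {0} \<Longrightarrow> \<exists>X\<in>M. W \<subseteq> X"
    using lifted_code_covers[OF k(2,3)] by metis
  obtain D where D: "is_covering_design m k 3 D" "card D = covering_number m k 3"
    using covering_number_attained[OF k(1,3)] by metis
  have finD: "finite D" and dimD: "\<And>X. X \<in> D \<Longrightarrow> is_subspace m k X"
    and covD: "\<And>W. is_subspace m 3 W \<Longrightarrow> \<exists>X\<in>D. W \<subseteq> X"
    using D by (auto simp: is_covering_design_def)
  define P where "P = Fvec k - {0}"
  obtain \<tau> where \<tau>: "inj_on \<tau> P" "\<And>p. p \<in> P \<Longrightarrow> \<tau> p \<in> lines k \<and> p \<in> \<tau> p"
    using points_to_lines[OF k(1)] unfolding P_def lines_def mem_Collect_eq by metis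
  \<comment> \<open>The selected point inverts \<open>\<tau>\<close> on the lines in its range,
    which is consistent by injectivity; on other lines any nonzero vector will do.\<close>
  have "\<exists>p. p \<in> T - {0} \<and> (\<forall>q\<in>P. \<tau> q = T \<longrightarrow> p = q)" if T: "T \<in> lines k" for T
  proof (cases "\<exists>q\<in>P. \<tau> q = T")
    case True
    then obtain q where "q \<in> P" "\<tau> q = T" by blast
    thus ?thesis using \<tau> by (intro exI[of _ q]) (auto simp: P_def inj_on_def)
  next
    case False
    have "\<not> T \<subseteq> {0}"
    proof
      assume "T \<subseteq> {0}"
      from card_mono[OF _ this] show False using T by (simp add: lines_def)
    qed
    thus ?thesis using False by blast
  qed
  then obtain pt where pt: "\<And>T. T \<in> lines k \<Longrightarrow> pt T \<in> T - {0}"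
      "\<And>q. q \<in> P \<Longrightarrow> pt (\<tau> q) = q"
    using \<tau>(2) by metis
  have "\<forall>T\<in>lines k. \<exists>f. additive_on (Fvec (m + 2)) f \<and> bij_betw f (Fvec (m + 2)) (preimg m k T) \<and>
    f ` U1 = preimg m k {0, pt T} \<and> f ` U0 = Fvec m"
    using line_iso[OF U0 U1 inc(1)] pt(1) by blast
  then obtain f where f: "\<And>T. T \<in> lines k \<Longrightarrow> additive_on (Fvec (m + 2)) (f T)"
      "\<And>T. T \<in> lines k \<Longrightarrow> bij_betw (f T) (Fvec (m + 2)) (preimg m k T)"
      "\<And>T. T \<in> lines k \<Longrightarrow> f T ` U1 = preimg m k {0, pt T}"
      "\<And>T. T \<in> lines k \<Longrightarrow> f T ` U0 = Fvec m"
    by metis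
  have finj: "inj_on (f T) (Fvec (m + 2))" and fim: "f T ` Fvec (m + 2) = preimg m k T" if "T \<in> lines k" for T
    using f(2)[OF that] by (auto simp: bij_betw_def)
  \<comment> \<open>Members in \<open>Sx\<close> are copied once for each line, giving the factor
    \<open>gauss2 k\<close>. Members in \<open>S1\<close> are copied once for each point, giving the
    factor \<open>2 ^ k - 1\<close>.\<close>
  define Sx where "Sx = {X\<in>S. \<not> X \<subseteq> U1 \<and> \<not> X \<subseteq> U2 \<and> \<not> X \<subseteq> U3}"
  define S1 where "S1 = {X\<in>S. X \<subseteq> U1 \<and> \<not> X \<subseteq> U0}"
  define Ca where "Ca = (\<lambda>(T, X). f T ` X) ` (lines k \<times> Sx)"
  define Cb where "Cb = (\<lambda>(p, X). f (\<tau> p) ` X) ` (P \<times> S1)"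
  have finP: "finite P" "finite Sx" "finite S1" using finS Fvec_finite by (auto simp: P_def Sx_def S1_def)
  have image_dim: "is_subspace (m + k) k (f T ` X)" if "T \<in> lines k" "X \<in> S" for T X
    by (rule is_subspace_image[OF dimS[OF that(2)] f(1)[OF that(1)] finj[OF that(1)]])
      (use fim[OF that(1)] in \<open>auto simp: preimg_def\<close>)
  have design: "is_covering_design (m + k) k 3 (M \<union> Ca \<union> Cb \<union> D)"
    unfolding is_covering_design_def
  proof (intro conjI ballI allI impI)
    show "finite (M \<union> Ca \<union> Cb \<union> D)"
      using M finD finP finite_lines by (simp add: Ca_def Cb_def)
  next
    fix X assume "X \<in> M \<union> Ca \<union> Cb \<union> D"
    then consider "X \<in> M" | "X \<in> Ca" | "X \<in> Cb" | "X \<in> D" by blast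
    thus "is_subspace (m + k) k X"
    proof cases
      case 4 thus ?thesis using dimD[of X] Fvec_mono[of m "m + k"] by (auto simp: is_subspace_iff)
    qed (use M(3) image_dim \<tau>(2) in \<open>auto simp: Ca_def Cb_def Sx_def S1_def\<close>)
  next
    fix W assume W: "is_subspace (m + k) 3 W"
    hence W': "W \<subseteq> Fvec (m + k)" "sub2 W" "card W = 8" by (auto simp: is_subspace_iff)
    have finW: "finite W" using W' Fvec_finite finite_subset by blast
    define A where "A = shift m ` W"
    have A: "A \<subseteq> Fvec k" "sub2 A" "finite A"
      using W' shift_Fvec sub2_image[OF W'(2) shift_additive] finW by (auto simp: A_def)
    have pull: "is_subspace (m + 2) 3 {x \<in> Fvec (m + 2). f T x \<in> W}"
        "f T ` {x \<in> Fvec (m + 2). f T x \<in> W} = W" if "T \<in> lines k" "W \<subseteq> preimg m k T" for T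
      using is_subspace_pullback[OF W f(1)[OF that(1)] finj[OF that(1)]] fim[OF that(1)] that by auto
    \<comment> \<open>The image \<open>A\<close> has dimension 3, dimension 0, or dimension 1 or 2,
      respectively.\<close>
    consider "W \<inter> Fvec m = {0}" | "W \<subseteq> Fvec m"
      | (mid) "W \<inter> Fvec m \<noteq> {0}" "\<not> W \<subseteq> Fvec m" by blast
    thus "\<exists>X\<in>M \<union> Ca \<union> Cb \<union> D. W \<subseteq> X"
    proof cases
      case 1 thus ?thesis using M(4)[OF W] by blast
    next
      case 2
      hence "is_subspace m 3 W" using W' by (simp add: is_subspace_iff)
      thus ?thesis using covD by blast
    next
      case mid
      then obtain v where v: "v \<in> W" "v \<notin> Fvec m" by blast
      define p where "p = shift m v"
      have p: "p \<in> A" "p \<noteq> 0" "p \<in> P"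
        using v A by (auto simp: p_def A_def P_def shift_eq_0_iff)
      show ?thesis
      proof (cases "A \<subseteq> {0, p}")
        case True
        \<comment> \<open>Here the image is the point \<open>p\<close>. On the line
          \<open>\<tau> p\<close> the selected point is \<open>p\<close> itself, so \<open>W\<close>
          lies in the copy of \<open>U1\<close>.\<close>
        define T where "T = \<tau> p"
        have T: "T \<in> lines k" "p \<in> T" "pt T = p" using \<tau>(2) p pt(2) by (auto simp: T_def)
        have "0 \<in> T" using T sub2_zero by (auto simp: lines_def)
        hence WT: "W \<subseteq> preimg m k T" and W1: "W \<subseteq> f T ` U1"
          using True W' T f(3)[OF T(1)] by (auto simp: preimg_def A_def)
        define W0 where "W0 = {x \<in> Fvec (m + 2). f T x \<in> W}"
        note pullT = pull[OF T(1) WT, folded W0_def]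
        have "W0 \<subseteq> U1"
        proof
          fix x assume x: "x \<in> W0"
          then obtain u where u: "u \<in> U1" "f T x = f T u" using W1 by (auto simp: W0_def)
          moreover have "u \<in> Fvec (m + 2)" using u U1 by (auto simp: is_subspace_iff)
          ultimately have "x = u" using x finj[OF T(1)] by (auto simp: W0_def inj_on_def)
          thus "x \<in> U1" using u by simp
        qed
        moreover have n0: "\<not> W0 \<subseteq> U0" using pullT(2) f(4)[OF T(1)] mid by blast
        moreover obtain X where X: "X \<in> S" "W0 \<subseteq> X" using covS[OF pullT(1)] by blast
        \<comment> \<open>If \<open>X\<close> were inside \<open>U2\<close> or \<open>U3\<close>,
          then \<open>W0\<close>, which lies in \<open>U1\<close>, would lie in the intersection
          \<open>U0\<close>.\<close>
        ultimately have nX: "\<not> X \<subseteq> U0" "\<not> X \<subseteq> U2" "\<not> X \<subseteq> U3" using assms(8-9) by blast+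
        have WX: "W \<subseteq> f T ` X" using pullT(2) X by blast
        show ?thesis
        proof (cases "X \<subseteq> U1")
          case True
          hence "f T ` X \<in> Cb" using X nX p unfolding Cb_def T_def S1_def
            by (intro image_eqI[of _ _ "(p, X)"]) auto
          thus ?thesis using WX by blast
        next
          case False
          hence "f T ` X \<in> Ca" using X nX T unfolding Ca_def Sx_def
            by (intro image_eqI[of _ _ "(T, X)"]) auto
          thus ?thesis using WX by blast
        qed
      next
        case False
        \<comment> \<open>A second nonzero image gives at least 3 elements in \<open>A\<close>, and
          the nonzero kernel of \<open>shift m\<close> on \<open>W\<close> gives fewer than 8. As a
          power of two, the order of \<open>A\<close> is 4, so \<open>A\<close> is a line.\<close>
        then obtain q where q: "q \<in> A" "q \<noteq> 0" "q \<noteq> p" by blast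
        have "card {0, p, q} \<le> card A" using p q A sub2_zero by (intro card_mono) auto
        hence ge: "card A \<ge> 3" using p q by simp
        obtain w where w: "w \<in> W" "w \<in> Fvec m" "w \<noteq> 0"
          using mid sub2_zero[OF W'(2)] sub2_zero[OF Fvec_sub2] by blast
        have "\<not> inj_on (shift m) W"
        proof
          assume "inj_on (shift m) W"
          moreover have "shift m w = shift m 0"
            using w shift_eq_0_iff sub2_zero[OF Fvec_sub2] by metis
          ultimately show False using w sub2_zero[OF W'(2)] by (meson inj_onD)
        qed
        hence "card A \<noteq> card W" unfolding A_def using finW eq_card_imp_inj_on by blast
        moreover have "card A \<le> card W" unfolding A_def by (rule card_image_le[OF finW])
        ultimately have lt: "card A < 2 ^ 3" using W' by simp
        obtain d where d: "card A = 2 ^ d" using card_sub2 A by blast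
        have "d < 3" using lt d by (metis nat_power_less_imp_less zero_less_numeral)
        moreover have "d \<noteq> 0" "d \<noteq> 1"
        proof -
          show "d \<noteq> 0" using ge d by (cases "d = 0") simp_all
          show "d \<noteq> 1" using ge d by (cases "d = 1") simp_all
        qed
        ultimately have "d = 2" by simp
        hence T: "A \<in> lines k" using A d by (simp add: lines_def)
        have WT: "W \<subseteq> preimg m k A" using W' by (auto simp: preimg_def A_def)
        define W0 where "W0 = {x \<in> Fvec (m + 2). f A x \<in> W}"
        note pullT = pull[OF T WT, folded W0_def]
        obtain X where X: "X \<in> S" "W0 \<subseteq> X" using covS[OF pullT(1)] by blast
        \<comment> \<open>Since \<open>W\<close> maps onto the whole line, its pullback lies in none
          of the three hyperplanes, and a member covering it must belong to
          \<open>Sx\<close>.\<close>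
        have "\<not> W0 \<subseteq> U" if "U0 \<subseteq> U" "is_subspace (m + 2) (m + 1) U" for U
          unfolding W0_def
          by (rule pullback_not_in_hyperplane[OF f(1)[OF T] f(2)[OF T] A_def f(4)[OF T] that W'(1)])
        hence "X \<in> Sx" using X U1 U2 U3 inc unfolding Sx_def by blast
        hence "f A ` X \<in> Ca" using T unfolding Ca_def by (intro image_eqI[of _ _ "(A, X)"]) auto
        moreover have "W \<subseteq> f A ` X" using pullT(2) X by blast
        ultimately show ?thesis by blast
      qed
    qed
  qed
  let ?c = "\<lambda>U. {X\<in>S. X \<subseteq> U}"
  \<comment> \<open>A member inside two of the hyperplanes lies in \<open>U0\<close>, so the three
    families have the common pairwise intersection \<open>?c U0\<close>.\<close>
  have "int (card (?c U1 \<union> ?c U2 \<union> ?c U3)) = int (card (?c U1)) + int (card (?c U2)) + int (card (?c U3)) - 2 * int (card (?c U0))"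
    using finS assms(8-10) by (intro card_Un3_common_Int) auto
  moreover have "Sx = S - (?c U1 \<union> ?c U2 \<union> ?c U3)" by (auto simp: Sx_def)
  hence "int (card Sx) = int (card S) - int (card (?c U1 \<union> ?c U2 \<union> ?c U3))"
    using finS by (simp add: card_Diff_subset of_nat_diff card_mono)
  ultimately have cSx: "int (card Sx) = int (card S) - int (card (?c U1)) - int (card (?c U2)) - int (card (?c U3)) + 2 * int (card (?c U0))"
    by simp
  have "S1 = ?c U1 - ?c U0" "?c U0 \<subseteq> ?c U1" using inc by (auto simp: S1_def)
  hence cS1: "int (card S1) = int (card (?c U1)) - int (card (?c U0))"
    using finS by (simp add: card_Diff_subset of_nat_diff card_mono)
  have cP: "int (card P) = 2 ^ k - 1"
    using sub2_zero[OF Fvec_sub2, of k] by (simp add: P_def Fvec_finite Fvec_card of_nat_diff)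
  have "card Ca \<le> card (lines k) * card Sx" unfolding Ca_def
    using card_image_le[of "lines k \<times> Sx"] finP finite_lines by (simp add: card_cartesian_product)
  also have "\<dots> \<le> gauss2 k * card Sx" using card_lines by simp
  finally have cCa: "card Ca \<le> gauss2 k * card Sx" .
  have cCb: "card Cb \<le> card P * card S1" unfolding Cb_def
    using card_image_le[of "P \<times> S1"] finP by (simp add: card_cartesian_product)
  have "card (M \<union> Ca \<union> Cb \<union> D) \<le> card M + card Ca + card Cb + card D"
    by (meson add_le_mono card_Un_le le_refl le_trans)
  hence "covering_number n k 3 \<le> 2 ^ (3 * m) + gauss2 k * card Sx + card P * card S1 + covering_number m k 3"
    using covering_number_le[OF design] cCa cCb M(2) D(2) unfolding n by linarith
  hence "int (covering_number n k 3) \<le> int (2 ^ (3 * m) + gauss2 k * card Sx + card P * card S1 + covering_number m k 3)"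
    by (rule of_nat_mono)
  thus ?thesis unfolding of_nat_add of_nat_mult cSx cS1 cP m_def by simp
qed

end
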